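(* Let $(G,\prec)$ be a Nyldon-like set over $A$, let $n\in G$, let $s$ be a nonempty suffix of $n$ (possibly $s=n$), let $a\in A^*$ be any word, and let $k$ be an integer with $k>\log_2(|n|)$. Then the word $sn^ka$ is not in $G$. Furthermore, the $G$-factorization of $n^ka$ begins with a factor $x$ with $|x|\ge|n|$ and $x\succeq n$.
   Context: $A$ is a finite alphabet with at least two letters; $|w|$ is the length of $w$. For $w\in A^+$, a $G$-factorization of $w$ is a sequence $(w_1,\dots,w_k)$, $k\ge 1$, of words of $G$ with $w=w_1w_2\cdots w_k$ and $w_1\preceq w_2\preceq\cdots\preceq w_k$. A Nyldon-like set is a pair $(G,\prec)$ with $G\subseteq A^+$ and $\prec$ a total order on $G$ such that: every letter of $A$ lies in $G$; a word $w$ of length at least $2$ lies in $G$ if and only if $w$ has no $G$-factorization with $k\ge 2$ factors; and for all $f,g\in G$ with $fg\in G$ we have $f\prec fg$. Every word of $A^+$ has exactly one $G$-factorization. *)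

theory Defs
  imports Complex_Main "HOL-Library.Sublist"
begin

text \<open>Words are lists: \<open>A\<^sup>*\<close> is \<open>lists A\<close>. The order \<open>prec\<close> is strict, and only its restriction
  to \<open>G\<close> is meaningful.\<close>

definition is_G_factorization ::
    "'a list set \<Rightarrow> ('a list \<Rightarrow> 'a list \<Rightarrow> bool) \<Rightarrow> 'a list \<Rightarrow> 'a list list \<Rightarrow> bool" where
  "is_G_factorization G prec w ws \<longleftrightarrow>
     ws \<noteq> [] \<and> set ws \<subseteq> G \<and> concat ws = w \<and> sorted_wrt (prec\<^sup>=\<^sup>=) ws"

definition nyldon_like ::
    "'a set \<Rightarrow> 'a list set \<Rightarrow> ('a list \<Rightarrow> 'a list \<Rightarrow> bool) \<Rightarrow> bool" where
  "nyldon_like A G prec \<longleftrightarrow>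
     G \<subseteq> lists A - {[]} \<and>
     irreflp_on G prec \<and> transp_on G prec \<and> totalp_on G prec \<and>
     (\<forall>x\<in>A. [x] \<in> G) \<and>
     (\<forall>w\<in>lists A. 2 \<le> length w \<longrightarrow>
        (w \<in> G \<longleftrightarrow> \<not> (\<exists>ws. is_G_factorization G prec w ws \<and> 2 \<le> length ws))) \<and>
     (\<forall>f\<in>G. \<forall>g\<in>G. f @ g \<in> G \<longrightarrow> prec f (f @ g))"

text \<open>Well defined for nonempty words over \<open>A\<close> by \<open>ex1_G_factorization\<close> below.\<close>

definition G_factorization ::
    "'a list set \<Rightarrow> ('a list \<Rightarrow> 'a list \<Rightarrow> bool) \<Rightarrow> 'a list \<Rightarrow> 'a list list" where
  "G_factorization G prec w = (THE ws. is_G_factorization G prec w ws)"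

definition word_pow :: "'a list \<Rightarrow> nat \<Rightarrow> 'a list" where
  "word_pow w k = concat (replicate k w)"

context
  fixes A :: "'a set" and G :: "'a list set" and prec :: "'a list \<Rightarrow> 'a list \<Rightarrow> bool"
  assumes nl: "nyldon_like A G prec"
begin

lemma G_sub: "x \<in> G \<Longrightarrow> x \<in> lists A \<and> x \<noteq> []"
  using nl unfolding nyldon_like_def by blast

lemma prec_trans: "prec x y \<Longrightarrow> prec y z \<Longrightarrow> x \<in> G \<Longrightarrow> y \<in> G \<Longrightarrow> z \<in> G \<Longrightarrow> prec x z"
  using nl unfolding nyldon_like_def by (meson transp_onD)

lemma prec_irrefl: "x \<in> G \<Longrightarrow> \<not> prec x x"
  using nl unfolding nyldon_like_def by (meson irreflp_onD)

lemma prec_total: "x \<in> G \<Longrightarrow> y \<in> G \<Longrightarrow> prec x y \<or> x = y \<or> prec y x"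
  using nl unfolding nyldon_like_def totalp_on_def by blast

lemma prec_append: "f \<in> G \<Longrightarrow> g \<in> G \<Longrightarrow> f @ g \<in> G \<Longrightarrow> prec f (f @ g)"
  using nl unfolding nyldon_like_def by blast

lemma factorization_single: "w \<in> G \<Longrightarrow> is_G_factorization G prec w [w]"
  by (simp add: is_G_factorization_def)

lemma factorization_length:
  assumes "set ws \<subseteq> G" shows "length ws \<le> length (concat ws)"
  using assms
proof (induction ws)
  case (Cons x xs)
  then have "x \<noteq> []" using G_sub by auto
  then have "1 \<le> length x" by (cases x) auto
  with Cons show ?case by simp
qed simp

lemma not_in_G:
  assumes "is_G_factorization G prec w ws" "2 \<le> length ws" shows "w \<notin> G"
proof
  assume "w \<in> G"
  have "2 \<le> length w"
    using factorization_length assms unfolding is_G_factorization_def by force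
  then show False using \<open>w \<in> G\<close> G_sub assms nl unfolding nyldon_like_def by blast
qed

lemma ex_factorization:
  assumes "w \<in> lists A" "w \<noteq> []" shows "\<exists>ws. is_G_factorization G prec w ws"
proof (cases "2 \<le> length w")
  case True
  then show ?thesis
    using assms nl factorization_single unfolding nyldon_like_def by blast
next
  case False
  then obtain x where "w = [x]" using assms by (cases w; cases "tl w") auto
  moreover have "x \<in> A" using assms calculation by simp
  ultimately have "w \<in> G" using nl unfolding nyldon_like_def by blast
  then show ?thesis using factorization_single by blast
qed

lemma factorization_last:
  assumes "is_G_factorization G prec w ws"
  obtains us x where "ws = us @ [x]" "x \<in> G" "w = concat us @ x" "set us \<subseteq> G"
    "sorted_wrt (prec\<^sup>=\<^sup>=) us" "\<forall>u\<in>set us. prec\<^sup>=\<^sup>= u x"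
  using assms unfolding is_G_factorization_def
  by (cases ws rule: rev_cases) (auto simp: sorted_wrt_append)

lemma factorization_append:
  assumes "is_G_factorization G prec v vs" "is_G_factorization G prec w ws"
    "prec\<^sup>=\<^sup>= (last vs) (hd ws)"
  shows "is_G_factorization G prec (v @ w) (vs @ ws)"
proof -
  let ?le = "prec\<^sup>=\<^sup>="
  have tr: "?le x z" if "?le x y" "?le y z" "x \<in> G" "y \<in> G" "z \<in> G" for x y z
    using that prec_trans by auto
  have "?le x y" if x: "x \<in> set vs" and y: "y \<in> set ws" for x y
  proof -
    have G: "set vs \<subseteq> G" "set ws \<subseteq> G" "vs \<noteq> []" "ws \<noteq> []"
      using assms unfolding is_G_factorization_def by auto
    have 1: "?le x (last vs)"
    proof -
      obtain us z where "vs = us @ [z]" using G(3) by (cases vs rule: rev_cases) auto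
      then show ?thesis
        using assms(1) x by (auto simp: is_G_factorization_def sorted_wrt_append)
    qed
    have 2: "?le (hd ws) y"
      using assms(2) y G(4) by (cases ws) (auto simp: is_G_factorization_def)
    have mem: "x \<in> G" "y \<in> G" "last vs \<in> G" "hd ws \<in> G" using G x y by auto
    show ?thesis
      using tr[OF tr[OF 1 assms(3)] 2] mem by blast
  qed
  then show ?thesis
    using assms unfolding is_G_factorization_def by (auto simp: sorted_wrt_append)
qed

text \<open>The last factor is the longest suffix lying in \<open>G\<close>, provided that every proper suffix in \<open>G\<close>
  of a shorter word \<open>x\<close> of \<open>G\<close> precedes \<open>x\<close>.\<close>

lemma last_longest_step:
  assumes IH: "\<And>x s. length x < length w \<Longrightarrow> x \<in> G \<Longrightarrow> strict_suffix s x \<Longrightarrow> s \<in> G \<Longrightarrow> prec s x"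
    and "is_G_factorization G prec w ws" "t \<in> G" "suffix t w"
  shows "suffix t (last ws)"
  using assms
proof (induction ws arbitrary: w)
  case Nil
  then show ?case by (simp add: is_G_factorization_def)
next
  case (Cons y ys)
  show ?case
  proof (cases "ys = []")
    case True
    then show ?thesis using Cons.prems by (simp add: is_G_factorization_def)
  next
    case False
    have w: "w = y @ concat ys" and ys: "is_G_factorization G prec (concat ys) ys"
      and yG: "y \<in> G" and le: "prec\<^sup>=\<^sup>= y (hd ys)"
      using Cons.prems(2) False by (simp_all add: is_G_factorization_def)
    have ylen: "length y < length w"
    proof -
      have "hd ys \<in> set ys" "set ys \<subseteq> G"
        using False ys by (simp_all add: is_G_factorization_def)
      then have "concat ys \<noteq> []" using G_sub by (meson concat_eq_Nil_conv subsetD)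
      then show ?thesis by (simp add: w del: length_concat concat_eq_Nil_conv)
    qed
    consider "suffix t (concat ys)" | v where "t = v @ concat ys" "v \<noteq> []" "suffix v y"
      using Cons.prems(4) unfolding w suffix_append by (metis append_Nil suffix_order.refl)
    then show ?thesis
    proof cases
      case 1
      have "suffix t (last ys)"
      proof (rule Cons.IH[OF _ ys Cons.prems(3) 1])
        fix x s assume "length x < length (concat ys)" "x \<in> G" "strict_suffix s x" "s \<in> G"
        moreover from this have "length x < length w" unfolding w length_append by linarith
        ultimately show "prec s x" using Cons.prems(1) by blast
      qed
      then show ?thesis using False by simp
    next
      case 2
      have "v \<in> lists A" using 2(3) G_sub[OF yG] by (auto simp: suffix_def)
      then obtain vs where vs: "is_G_factorization G prec v vs" using ex_factorization 2 by blast
      obtain us z where us: "vs = us @ [z]" "z \<in> G" "v = concat us @ z"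
        using factorization_last[OF vs] by metis
      have "suffix z y" using us 2(3) by (auto simp: suffix_def)
      then have "z = y \<or> prec z y"
        using Cons.prems(1)[OF ylen yG _ us(2)] unfolding strict_suffix_def by blast
      moreover have "hd ys \<in> G" using ys False hd_in_set[of ys] unfolding is_G_factorization_def by blast
      ultimately have "prec\<^sup>=\<^sup>= z (hd ys)"
        using le us(2) yG prec_trans[of z y "hd ys"] by (metis sup2CI sup2E)
      then have "prec\<^sup>=\<^sup>= (last vs) (hd ys)" using us(1) by simp
      from factorization_append[OF vs ys this] 2
      have "is_G_factorization G prec t (vs @ ys)" by simp
      moreover have "2 \<le> length (vs @ ys)" using us(1) False by (cases ys) auto
      ultimately show ?thesis using not_in_G Cons.prems(3) by blast
    qed
  qed
qed

lemma proper_suffix_prec: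
  "w \<in> G \<Longrightarrow> strict_suffix s w \<Longrightarrow> s \<in> G \<Longrightarrow> prec s w"
proof (induction "length w" arbitrary: w s rule: less_induct)
  case less
  define S where "S = {t. t \<in> G \<and> strict_suffix t w}"
  have bound: "\<And>t. t \<in> S \<Longrightarrow> length t < Suc (length w)"
    unfolding S_def by (auto simp: strict_suffix_def suffix_def)
  have "s \<in> S" using less.prems S_def by simp
  then obtain t where t: "t \<in> S" and tmax: "\<And>u. u \<in> S \<Longrightarrow> length u \<le> length t"
    using ex_has_greatest_nat[of "\<lambda>u. u \<in> S" s length "Suc (length w)"] bound
    by (metis less_imp_le)
  have tG: "t \<in> G" and tw: "strict_suffix t w" using t S_def by auto
  obtain p where p: "w = p @ t" "p \<noteq> []" using tw by (auto simp: strict_suffix_def suffix_def)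
  have "p \<in> lists A" using p G_sub[OF less.prems(1)] by simp
  then obtain ps where ps: "is_G_factorization G prec p ps" using ex_factorization p by blast
  obtain us z where us: "ps = us @ [z]" "z \<in> G" "p = concat us @ z" "set us \<subseteq> G"
    using factorization_last[OF ps] by metis
  have nle: "\<not> prec\<^sup>=\<^sup>= z t"
  proof
    assume "prec\<^sup>=\<^sup>= z t"
    then have "is_G_factorization G prec w (ps @ [t])"
      using factorization_append[OF ps factorization_single[OF tG]] us p by simp
    moreover have "2 \<le> length (ps @ [t])" using us(1) by simp
    ultimately show False using not_in_G less.prems(1) by blast
  qed
  have "us = []"
  proof (rule ccontr)
    assume "us \<noteq> []"
    then have "concat us \<noteq> []" using us(4) G_sub by (cases us) auto
    then have zt: "strict_suffix (z @ t) w" using p us(3)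
      by (auto simp: strict_suffix_def suffix_def)
    have zne: "z \<noteq> []" using G_sub us by blast
    have "z @ t \<notin> G"
    proof
      assume "z @ t \<in> G"
      then have "length (z @ t) \<le> length t" using zt tmax S_def by blast
      then show False using zne by simp
    qed
    have "z @ t \<in> lists A" using G_sub us tG by auto
    then obtain qs where qs: "is_G_factorization G prec (z @ t) qs"
      using ex_factorization zne by blast
    have lt: "length (z @ t) < length w" using p us(3) \<open>concat us \<noteq> []\<close> by simp
    have "suffix t (last qs)"
    proof (rule last_longest_step[OF _ qs tG])
      fix x s assume "length x < length (z @ t)" "x \<in> G" "strict_suffix s x" "s \<in> G"
      then show "prec s x" using less.hyps lt by force
    qed (simp add: suffix_def)
    obtain rs q where q: "qs = rs @ [q]" "q \<in> G" "z @ t = concat rs @ q" "set rs \<subseteq> G"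
      "sorted_wrt (prec\<^sup>=\<^sup>=) rs" "\<forall>u\<in>set rs. prec\<^sup>=\<^sup>= u q"
      using factorization_last[OF qs] by metis
    have "suffix q (z @ t)" using q(3) by (auto simp: suffix_def)
    then have "suffix q w" using zt suffix_order.trans unfolding strict_suffix_def by blast
    moreover have "q \<noteq> w"
      using q(3) lt by (metis le_add2 length_append linorder_not_less)
    ultimately have "q \<in> S" using q(2) unfolding S_def strict_suffix_def by simp
    then have "length q \<le> length t" using tmax by blast
    then have "q = t" using \<open>suffix t (last qs)\<close> q(1) by (auto simp: suffix_def)
    then have z: "z = concat rs" using q(3) by simp
    have "rs \<noteq> []" using z zne by auto
    then have rs: "is_G_factorization G prec z rs"
      using z q unfolding is_G_factorization_def by simp
    then have "\<not> 2 \<le> length rs" using not_in_G us(2) by blast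
    then obtain r where "rs = [r]" using \<open>rs \<noteq> []\<close> by (cases rs) (auto simp: Suc_le_eq)
    then have "prec\<^sup>=\<^sup>= z t" using z q(6) \<open>q = t\<close> by simp
    then show False using nle by simp
  qed
  then have "p = z" using us by simp
  then have "prec t p" using nle prec_total[OF us(2) tG] by auto
  moreover have "prec p w" using prec_append p tG us(2) \<open>p = z\<close> less.prems(1) by simp
  ultimately have tw_prec: "prec t w" using prec_trans tG us(2) \<open>p = z\<close> less.prems(1) by blast
  show ?case
  proof (cases "s = t")
    case False
    have "suffix s t"
      using suffix_length_suffix[of s w t] less.prems(2) tw tmax[OF \<open>s \<in> S\<close>]
      by (auto simp: strict_suffix_def)
    then have "prec s t"
      using less.hyps[of t s] tG less.prems(3) False p by (simp add: strict_suffix_def)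
    then show ?thesis using tw_prec prec_trans less.prems tG by blast
  qed (use tw_prec in simp)
qed

lemma factorization_unique:
  "is_G_factorization G prec w us \<Longrightarrow> is_G_factorization G prec w vs \<Longrightarrow> us = vs"
proof (induction us arbitrary: w vs rule: rev_induct)
  case Nil
  then show ?case by (simp add: is_G_factorization_def)
next
  case (snoc x xs)
  obtain ys y where y: "vs = ys @ [y]" "y \<in> G" "w = concat ys @ y" "set ys \<subseteq> G"
      "sorted_wrt (prec\<^sup>=\<^sup>=) ys"
    using factorization_last[OF snoc.prems(2)] by metis
  have x: "x \<in> G" "w = concat xs @ x" "set xs \<subseteq> G" "sorted_wrt (prec\<^sup>=\<^sup>=) xs"
    using snoc.prems(1) by (auto simp: is_G_factorization_def sorted_wrt_append)
  have "suffix y (last (xs @ [x]))"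
    by (rule last_longest_step[OF _ snoc.prems(1) y(2)])
      (use proper_suffix_prec y(3) in \<open>auto simp: suffix_def\<close>)
  moreover have "suffix x (last vs)"
    by (rule last_longest_step[OF _ snoc.prems(2) x(1)])
      (use proper_suffix_prec x(2) in \<open>auto simp: suffix_def\<close>)
  ultimately have "x = y" using suffix_order.antisym[of x y] y(1) by simp
  then have eq: "concat xs = concat ys" using x y by simp
  have "xs = ys"
  proof (cases "xs = [] \<or> ys = []")
    case True
    then show ?thesis using eq x(3) y(4) G_sub by (cases xs; cases ys) auto
  next
    case False
    then show ?thesis using snoc.IH[of "concat xs" ys] x y eq
      by (auto simp: is_G_factorization_def)
  qed
  then show ?case using \<open>x = y\<close> y(1) by simp
qed

theorem ex1_G_factorization:
  assumes "w \<in> lists A" "w \<noteq> []"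
  shows "\<exists>!ws. is_G_factorization G prec w ws"
  using ex_factorization[OF assms] factorization_unique by blast

end

end

theory Submission
  imports Defs
begin

text \<open>The idea is Lazard elimination. If \<open>e\<close> is the least letter of an alphabet, then \<open>G - {e}\<close> is
  again Nyldon-like over the code of all \<open>b e\<^sup>i\<close> with \<open>b \<noteq> e\<close> a letter. Eliminate least letters until
  \<open>n\<close> itself is the least letter, keeping the word in the form \<open>n\<^sup>j \<phi>\<close>. A copy of \<open>n\<close> is
  lost only when \<open>\<phi>\<close> starts with the eliminated letter, which then sticks to the last copy of \<open>n\<close>.
  Right after a loss, \<open>n\<close> and \<open>\<phi>\<close> agree in all letters of \<open>n\<close> but the last, and the next loss requires
  this common prefix to vanish; by then the number of letters of \<open>n\<close> has been halved. So at most
  \<open>log\<^sub>2 |n| + 1\<close> copies are lost and in the end the word starts with a letter \<open>n\<close> or \<open>n e\<^sup>i\<dots>\<close>, over an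
  alphabet with least letter \<open>n\<close>. The last factor of \<open>s\<close> is a suffix of \<open>n\<close>, hence at most \<open>n\<close>, so
  that the factorization of \<open>s\<close> can be put in front of that of \<open>n\<^sup>k a\<close>.\<close>

section \<open>Gluing a letter to the letter before it\<close>

text \<open>Reads a sequence of letters as a sequence of blocks \<open>b e ... e\<close>. The first
  letter opens a block even if it is \<open>e\<close>, so the result is a word over the eliminated
  alphabet only for lists that do not start with \<open>e\<close>.\<close>

function absorb :: "'a list \<Rightarrow> 'a list list \<Rightarrow> 'a list list" where
  "absorb e [] = []"
| "absorb e (b # L) = (b @ concat (takeWhile ((=) e) L)) # absorb e (dropWhile ((=) e) L)"
  by pat_completeness auto
termination
  by (relation "measure (length \<circ> snd)") (auto simp: length_dropWhile_le le_imp_less_Suc)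

lemma concat_absorb [simp]: "concat (absorb e L) = concat L"
proof (induction e L rule: absorb.induct)
  case (2 e b L)
  have "concat L = concat (takeWhile ((=) e) L @ dropWhile ((=) e) L)" by simp
  then show ?case using 2 by (simp del: takeWhile_dropWhile_id)
qed simp

lemma absorb_eq_Nil_iff [simp]: "absorb e L = [] \<longleftrightarrow> L = []"
  by (cases L) auto

lemma length_absorb_le: "length (absorb e L) \<le> length L"
proof (induction e L rule: absorb.induct)
  case (2 e b L)
  then show ?case using length_dropWhile_le[of "(=) e" L] by simp
qed simp

text \<open>Each \<open>e\<close> glued to the first letter shortens the list by one; in
  \<open>slack_step\<close> this decrease pays for a possible reversal of order.\<close>

lemma hd_absorb:
  assumes "L \<noteq> []"
  obtains i where "hd (absorb e L) = hd L @ word_pow e i" "length (absorb e L) + i \<le> length L"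
proof -
  obtain b M where L: "L = b # M" using assms by (cases L) auto
  let ?i = "length (takeWhile ((=) e) M)"
  have "takeWhile ((=) e) M = replicate ?i e"
    by (intro replicate_eqI) (auto dest: set_takeWhileD)
  then have "hd (absorb e L) = hd L @ word_pow e ?i"
    by (metis L absorb.simps(2) list.sel(1) word_pow_def)
  moreover have "length M = ?i + length (dropWhile ((=) e) M)"
    by (metis length_append takeWhile_dropWhile_id)
  then have "length (absorb e L) + ?i \<le> length L"
    using length_absorb_le[of e "dropWhile ((=) e) M"] L by simp
  ultimately show ?thesis by (rule that)
qed

text \<open>No block crosses the cut when the right part does not start with \<open>e\<close>.
  Together with \<open>absorb_append_replicate\<close> this tells how a common prefix survives an
  elimination: it is kept, or its last block takes in the copies of \<open>e\<close> that
  follow.\<close>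

lemma absorb_append:
  "u = [] \<or> hd u \<noteq> e \<Longrightarrow> absorb e (P @ u) = absorb e P @ absorb e u"
proof (induction e P rule: absorb.induct)
  case (2 e b L)
  have "takeWhile ((=) e) u = []" "dropWhile ((=) e) u = u"
    using 2(2) by (cases u; auto)+
  then have "takeWhile ((=) e) (L @ u) = takeWhile ((=) e) L"
    "dropWhile ((=) e) (L @ u) = dropWhile ((=) e) L @ u"
    by (induction L) auto
  then show ?case using 2 by simp
qed simp

lemma absorb_append_replicate:
  "P \<noteq> [] \<Longrightarrow> absorb e (P @ replicate i e) = butlast (absorb e P) @ [last (absorb e P) @ word_pow e i]"
proof (induction e P rule: absorb.induct)
  case (2 e b L)
  show ?case
  proof (cases "dropWhile ((=) e) L = []")
    case True
    then have "\<forall>x\<in>set L. e = x" by simp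
    then have "takeWhile ((=) e) (L @ replicate i e) = L @ replicate i e"
      "takeWhile ((=) e) L = L" "dropWhile ((=) e) (L @ replicate i e) = []"
      by (auto simp: takeWhile_eq_all_conv)
    with True show ?thesis by (simp only: absorb.simps) (simp add: word_pow_def)
  next
    case False
    then obtain x where "x \<in> set L" "e \<noteq> x" by auto
    then have "takeWhile ((=) e) (L @ replicate i e) = takeWhile ((=) e) L"
      "dropWhile ((=) e) (L @ replicate i e) = dropWhile ((=) e) L @ replicate i e"
      by (simp_all add: takeWhile_append1 dropWhile_append1)
    with 2 False show ?thesis by simp
  qed
qed simp

lemma absorb_append_replicate_append:
  assumes "P \<noteq> []" "u = [] \<or> hd u \<noteq> e"
  shows "absorb e (P @ replicate i e @ u) =
    butlast (absorb e P) @ (last (absorb e P) @ word_pow e i) # absorb e u"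
  using absorb_append[OF assms(2), of "P @ replicate i e"] absorb_append_replicate[OF assms(1)]
  by simp

lemma split_leading:
  obtains i r where "L = replicate i e @ r" "r = [] \<or> hd r \<noteq> e"
proof -
  have "takeWhile ((=) e) L = replicate (length (takeWhile ((=) e) L)) e"
    by (intro replicate_eqI) (auto dest: set_takeWhileD)
  then have "L = replicate (length (takeWhile ((=) e) L)) e @ dropWhile ((=) e) L"
    by (metis takeWhile_dropWhile_id)
  moreover have "dropWhile ((=) e) L = [] \<or> hd (dropWhile ((=) e) L) \<noteq> e"
    using hd_dropWhile[of "(=) e" L] by metis
  ultimately show ?thesis by (rule that)
qed

lemma word_pow_add: "word_pow w (i + j) = word_pow w i @ word_pow w j"
  by (simp add: word_pow_def replicate_add)

lemma word_pow_Suc: "word_pow w (Suc i) = w @ word_pow w i"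
  by (simp add: word_pow_def)

lemma word_pow_Suc_right: "word_pow w (Suc i) = word_pow w i @ w"
  by (metis Suc_eq_plus1 append_Nil2 concat.simps(1) replicate_0 word_pow_Suc word_pow_add word_pow_def One_nat_def)

lemma concat_word_pow: "concat (word_pow L i) = word_pow (concat L) i"
  by (induction i) (simp_all add: word_pow_def)

lemma concat_map_concat: "concat (map concat Ls) = concat (concat Ls)"
  by (induction Ls) auto

section \<open>The alphabet after eliminating one letter\<close>

text \<open>A stage controls only words of length at most \<open>N\<close>, so the longer words
  \<open>b e ... e\<close> are left out.\<close>

definition absorbed :: "nat \<Rightarrow> 'a list set \<Rightarrow> 'a list \<Rightarrow> 'a list set" where
  "absorbed N X e = {b @ word_pow e i | b i. b \<in> X - {e} \<and> length (b @ word_pow e i) \<le> N}"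

lemma absorb_in_absorbed:
  "L \<in> lists X \<Longrightarrow> L = [] \<or> hd L \<noteq> e \<Longrightarrow> length (concat L) \<le> N \<Longrightarrow>
    absorb e L \<in> lists (absorbed N X e)"
proof (induction e L rule: absorb.induct)
  case (2 e b L)
  let ?i = "length (takeWhile ((=) e) L)"
  have tw: "takeWhile ((=) e) L = replicate ?i e"
    by (intro replicate_eqI) (auto dest: set_takeWhileD)
  have cL: "concat L = concat (takeWhile ((=) e) L) @ concat (dropWhile ((=) e) L)"
    by (metis concat_append takeWhile_dropWhile_id)
  have "b @ concat (takeWhile ((=) e) L) \<in> absorbed N X e"
    unfolding absorbed_def
  proof (intro CollectI exI conjI)
    show "b @ concat (takeWhile ((=) e) L) = b @ word_pow e ?i"
      using tw by (metis word_pow_def)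
    then show "length (b @ word_pow e ?i) \<le> N"
      using 2(4) cL by (metis append_assoc concat.simps(2) length_append add_leD1)
  qed (use 2 in auto)
  moreover have "absorb e (dropWhile ((=) e) L) \<in> lists (absorbed N X e)"
  proof (rule 2(1))
    show "dropWhile ((=) e) L \<in> lists X" using 2(2) by (auto dest: set_dropWhileD)
    show "dropWhile ((=) e) L = [] \<or> hd (dropWhile ((=) e) L) \<noteq> e"
      using hd_dropWhile[of "(=) e" L] by metis
    show "length (concat (dropWhile ((=) e) L)) \<le> N"
      using 2(4) cL by simp
  qed
  ultimately show ?case by simp
qed simp

text \<open>Regrouping can be undone by expanding every block. This carries injectivity and
  factorizations over from \<open>X\<close> to the new alphabet.\<close>

lemma absorbed_expand:
  "L' \<in> lists (absorbed N X e) \<Longrightarrow> e \<in> X \<Longrightarrow>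
    \<exists>L\<in>lists X. absorb e L = L' \<and> (L = [] \<or> hd L \<noteq> e)"
proof (induction L')
  case (Cons c R')
  then obtain R where R: "R \<in> lists X" "absorb e R = R'" "R = [] \<or> hd R \<noteq> e" by auto
  obtain b i where b: "c = b @ word_pow e i" "b \<in> X" "b \<noteq> e"
    using Cons.prems by (auto simp: absorbed_def)
  have "absorb e ([b] @ replicate i e @ R) = c # R'"
    using absorb_append_replicate_append[of "[b]" R e i] R b by simp
  then show ?case using R b Cons.prems(2)
    by (intro bexI[of _ "[b] @ replicate i e @ R"]) auto
qed auto

section \<open>Alphabets of the elimination and the potential\<close>

text \<open>\<open>X\<close> is one of the alphabets of the elimination process. The bound \<open>N\<close> on the length of words
  leaves finitely many words to consider, which provides a least one.\<close>

definition stage :: "'a list set \<Rightarrow> ('a list \<Rightarrow> 'a list \<Rightarrow> bool) \<Rightarrow> nat \<Rightarrow> 'a list set \<Rightarrow> bool" where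
  "stage G prec N X \<longleftrightarrow> X \<subseteq> G \<and> inj_on concat (lists X) \<and>
    (\<forall>L\<in>lists X. L \<noteq> [] \<longrightarrow> length (concat L) \<le> N \<longrightarrow>
      (\<exists>Ls. set Ls \<subseteq> lists X \<and> is_G_factorization G prec (concat L) (map concat Ls)))"

definition stage_words :: "'a list set \<Rightarrow> nat \<Rightarrow> 'a list set \<Rightarrow> 'a list set" where
  "stage_words G N X = {w \<in> G. length w \<le> N \<and> w \<in> concat ` lists X}"

text \<open>The minimum ranges over all bounded words of \<open>G\<close> over \<open>X\<close>, not
  only over the letters; that it is a letter is part of \<open>stage_minD\<close>.\<close>

definition stage_min ::
    "'a list set \<Rightarrow> ('a list \<Rightarrow> 'a list \<Rightarrow> bool) \<Rightarrow> nat \<Rightarrow> 'a list set \<Rightarrow> 'a list \<Rightarrow> bool" where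
  "stage_min G prec N X e \<longleftrightarrow> e \<in> stage_words G N X \<and> (\<forall>w\<in>stage_words G N X. prec\<^sup>=\<^sup>= e w)"

text \<open>Here \<open>\<nu>\<close> and \<open>\<phi>\<close> are the decompositions of \<open>n\<close> and of the rest of the word into letters of the
  current alphabet. When the last letter \<open>p\<close> of the common prefix \<open>P\<close> absorbs \<open>hd v\<close>, the length of \<open>u\<close>
  grows by one, but then \<open>hd u\<close> becomes \<open>p\<close>, which precedes the new \<open>hd v\<close>; the order can be
  reversed only by shortening \<open>u\<close> or \<open>P\<close>. This is what makes \<open>2 |u| + |P|\<close> the right
  potential.\<close>

definition slack :: "('a list \<Rightarrow> 'a list \<Rightarrow> bool) \<Rightarrow> nat \<Rightarrow> 'a list list \<Rightarrow> 'a list list \<Rightarrow> bool" where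
  "slack prec j \<nu> \<phi> \<longleftrightarrow> length \<nu> < 2 ^ j \<or>
    (\<exists>P u v. \<nu> = P @ u \<and> \<phi> = P @ v \<and> u \<noteq> [] \<and> v \<noteq> [] \<and> hd u \<noteq> hd v \<and>
       2 * length u + length P \<le> 2 ^ (j + 1) \<and>
       (prec (hd u) (hd v) \<or> 2 * length u + length P < 2 ^ (j + 1)) \<and>
       (j = 0 \<longrightarrow> length (concat \<nu>) \<le> length (hd \<phi>)))"

section \<open>Least words over an alphabet\<close>

context
  fixes A :: "'a set" and G :: "'a list set" and prec :: "'a list \<Rightarrow> 'a list \<Rightarrow> bool"
    and N :: nat
  assumes nl: "nyldon_like A G prec"
begin

lemma le_trans:
  "prec\<^sup>=\<^sup>= x y \<Longrightarrow> prec\<^sup>=\<^sup>= y z \<Longrightarrow> x \<in> G \<Longrightarrow> y \<in> G \<Longrightarrow> z \<in> G \<Longrightarrow> prec\<^sup>=\<^sup>= x z"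
  using prec_trans[OF nl, of x y z] by auto

lemma le_antisym: "prec\<^sup>=\<^sup>= x y \<Longrightarrow> prec\<^sup>=\<^sup>= y x \<Longrightarrow> x \<in> G \<Longrightarrow> y \<in> G \<Longrightarrow> x = y"
  using prec_trans[OF nl, of x y x] prec_irrefl[OF nl, of x] by auto

lemma factorization_Cons:
  assumes "is_G_factorization G prec w (x # xs)" "y \<in> G" "prec\<^sup>=\<^sup>= y x"
  shows "y @ w \<notin> G"
proof -
  have "is_G_factorization G prec (y @ w) ([y] @ (x # xs))"
    by (rule factorization_append[OF nl factorization_single[OF nl assms(2)] assms(1)])
      (use assms in simp)
  then show ?thesis using not_in_G[OF nl] by force
qed

context
  fixes X :: "'a list set"
  assumes X: "stage G prec N X"
begin

lemma stage_inj: "L \<in> lists X \<Longrightarrow> M \<in> lists X \<Longrightarrow> concat L = concat M \<Longrightarrow> L = M"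
  using X unfolding stage_def inj_on_def by blast

lemma stage_factorization:
  assumes "L \<in> lists X" "L \<noteq> []" "length (concat L) \<le> N"
  obtains Ls where "is_G_factorization G prec (concat L) (map concat Ls)"
    "concat Ls = L" "Ls \<noteq> []"
    "\<And>M. M \<in> set Ls \<Longrightarrow> M \<in> lists X \<and> M \<noteq> [] \<and> concat M \<in> stage_words G N X"
proof -
  obtain Ls where Ls: "set Ls \<subseteq> lists X" "is_G_factorization G prec (concat L) (map concat Ls)"
    using X assms unfolding stage_def by blast
  note cc = concat_map_concat[of Ls]
  have mem: "concat Ls \<in> lists X" using Ls(1) by (induction Ls) auto
  have eq: "concat (concat Ls) = concat L" using Ls(2) cc by (simp add: is_G_factorization_def)
  show ?thesis
  proof (rule that[OF Ls(2)])
    show "concat Ls = L" using stage_inj[OF mem assms(1) eq] .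
    show "Ls \<noteq> []" using Ls(2) by (auto simp: is_G_factorization_def)
    fix M assume M: "M \<in> set Ls"
    have "concat M \<in> G" using Ls(2) M by (auto simp: is_G_factorization_def)
    moreover have "length (concat M) \<le> length (concat (map concat Ls))"
    proof -
      obtain as bs where "Ls = as @ M # bs" using M by (meson split_list)
      then show ?thesis by simp
    qed
    ultimately show "M \<in> lists X \<and> M \<noteq> [] \<and> concat M \<in> stage_words G N X"
      using Ls(1) M assms(3) G_sub[OF nl, of "concat M"] cc eq unfolding stage_words_def
      by auto
  qed
qed

text \<open>Splitting off the last factor of \<open>tl L\<close>, rather than the longest proper suffix in \<open>G\<close> of the
  whole word, keeps the cut on a boundary between letters of \<open>X\<close>.\<close>

lemma ex_stage_word_prec:
  assumes "L \<in> lists X" "2 \<le> length L" "length (concat L) \<le> N" "concat L \<in> G"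
  shows "\<exists>f\<in>stage_words G N X. prec f (concat L)"
proof -
  obtain x R where L: "L = x # R" "R \<noteq> []" using assms(2) by (cases L; cases "tl L") auto
  have len: "length (concat R) \<le> N" using assms(3) L by simp
  obtain Rs where Rs: "is_G_factorization G prec (concat R) (map concat Rs)" "concat Rs = R" "Rs \<noteq> []"
    "\<And>M. M \<in> set Rs \<Longrightarrow> M \<in> lists X \<and> M \<noteq> [] \<and> concat M \<in> stage_words G N X"
    using stage_factorization[of R] assms(1) L len by (metis Cons_in_lists_iff)
  define g where "g = last Rs"
  have g: "g \<in> lists X" "g \<noteq> []" "concat g \<in> stage_words G N X"
    using Rs(4)[of g] last_in_set[OF Rs(3)] g_def by auto
  \<comment> \<open>\<open>F\<close> is what precedes \<open>g\<close> in \<open>L\<close>. Once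
    \<open>F\<close> is known to be in \<open>G\<close>, \<open>prec_append\<close> makes it the
    desired smaller word.\<close>
  define F where "F = x # concat (butlast Rs)"
  have R: "R = concat (butlast Rs) @ g"
    using Rs(2,3) g_def by (metis append_butlast_last_id concat.simps concat_append append_Nil2)
  then have LF: "L = F @ g" using L F_def by simp
  have F: "F \<in> lists X" "F \<noteq> []" using assms(1) LF F_def by auto
  have lenF: "length (concat F) \<le> N" using assms(3) LF by simp
  obtain Fs where Fs: "is_G_factorization G prec (concat F) (map concat Fs)" "concat Fs = F" "Fs \<noteq> []"
    "\<And>M. M \<in> set Fs \<Longrightarrow> M \<in> lists X \<and> M \<noteq> [] \<and> concat M \<in> stage_words G N X"
    using stage_factorization[OF F lenF] by metis
  define z where "z = last Fs"
  have z: "z \<in> lists X" "z \<noteq> []" "concat z \<in> stage_words G N X"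
    using Fs(4)[of z] last_in_set[OF Fs(3)] z_def by auto
  have Fz: "F = concat (butlast Fs) @ z"
    using Fs(2,3) z_def by (metis append_butlast_last_id concat.simps concat_append append_Nil2)
  have gG: "concat g \<in> G" and zG: "concat z \<in> G" using g z by (auto simp: stage_words_def)
  have nle: "\<not> prec\<^sup>=\<^sup>= (concat z) (concat g)"
  proof
    assume le: "prec\<^sup>=\<^sup>= (concat z) (concat g)"
    have "is_G_factorization G prec (concat F @ concat g) (map concat Fs @ [concat g])"
      by (rule factorization_append[OF nl Fs(1) factorization_single[OF nl gG]])
        (use le Fs(3) z_def in \<open>simp add: last_map\<close>)
    then have "concat L \<notin> G" using not_in_G[OF nl] Fs(3) LF by (cases Fs) force+
    then show False using assms(4) by simp
  qed
  \<comment> \<open>Otherwise \<open>z @ g\<close> is a suffix of \<open>R\<close>. Its last factor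
    \<open>q\<close> has suffix \<open>g\<close>, and \<open>q\<close> is itself a suffix of
    \<open>g\<close>, because \<open>g\<close> is the last factor of \<open>R\<close>. So
    \<open>q = g\<close>, and as \<open>z\<close> spells a word of \<open>G\<close>, the factors of
    \<open>z @ g\<close> are \<open>z\<close> and \<open>g\<close>, in the order excluded by
    \<open>nle\<close>.\<close>
  have "butlast Fs = []"
  proof (rule ccontr)
    assume ne: "butlast Fs \<noteq> []"
    have "hd (butlast Fs) \<noteq> []" using ne Fs(4) by (meson hd_in_set in_set_butlastD)
    then have "concat (butlast Fs) \<noteq> []" using ne by (cases "butlast Fs") auto
    then obtain F0 where F0: "concat (butlast Fs) = x # F0" using Fz F_def
      by (cases "concat (butlast Fs)") auto
    then have RF: "R = F0 @ z @ g" using Fz F_def R by simp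
    have zg: "z @ g \<in> lists X" "z @ g \<noteq> []" using z g by auto
    have lzg: "length (concat (z @ g)) \<le> N" using len RF by simp
    obtain Zs where Zs: "is_G_factorization G prec (concat (z @ g)) (map concat Zs)"
      "concat Zs = z @ g" "Zs \<noteq> []"
      "\<And>M. M \<in> set Zs \<Longrightarrow> M \<in> lists X \<and> M \<noteq> [] \<and> concat M \<in> stage_words G N X"
      using stage_factorization[OF zg lzg] by metis
    define q where "q = last Zs"
    have q: "q \<in> lists X" "concat q \<in> G"
      using Zs(4)[of q] last_in_set[OF Zs(3)] q_def by (auto simp: stage_words_def)
    have zgq: "z @ g = concat (butlast Zs) @ q"
      using Zs(2,3) q_def by (metis append_butlast_last_id concat.simps concat_append append_Nil2)
    have s1: "suffix (concat g) (concat q)"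
      using last_longest_step[OF nl _ Zs(1) gG] proper_suffix_prec[OF nl] Zs(3) q_def
      by (auto simp: last_map suffix_def)
    have "concat R = concat F0 @ concat (concat (butlast Zs)) @ concat q"
      using RF zgq by (metis concat_append)
    then have "suffix (concat q) (concat R)" by (auto simp: suffix_def)
    then have s2: "suffix (concat q) (concat g)"
      using last_longest_step[OF nl _ Rs(1) q(2)] proper_suffix_prec[OF nl] Rs(3) g_def
      by (auto simp: last_map)
    have "q = g" using s1 s2 stage_inj[OF q(1) g(1)] suffix_order.antisym by blast
    then have zZ: "z = concat (butlast Zs)" using zgq by simp
    have Zs_eq: "Zs = butlast Zs @ [g]" using Zs(3) q_def \<open>q = g\<close> by (metis append_butlast_last_id)
    have bne: "butlast Zs \<noteq> []" using zZ z(2) by auto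
    have cz: "concat (map concat (butlast Zs)) = concat z"
      using zZ concat_map_concat by metis
    have fz: "is_G_factorization G prec (concat z) (map concat (butlast Zs))"
      using Zs(1) bne cz unfolding is_G_factorization_def
      by (subst (asm) (2 3 4 5) Zs_eq) (auto simp: sorted_wrt_append)
    have "map concat (butlast Zs) = [concat z]"
      using factorization_unique[OF nl fz factorization_single[OF nl zG]] .
    then have "prec\<^sup>=\<^sup>= (concat z) (concat g)"
      using Zs(1) unfolding is_G_factorization_def
      by (subst (asm) (2 3 4 5) Zs_eq) (auto simp: sorted_wrt_append)
    then show False using nle by simp
  qed
  then have "F = z" using Fz by simp
  then have "prec (concat F) (concat L)"
    using prec_append[OF nl zG gG] LF assms(4) by simp
  then show ?thesis using \<open>F = z\<close> z(3) by blast
qed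

text \<open>A least word with two or more letters would have a smaller one below it by
  \<open>ex_stage_word_prec\<close>, so the least word is a letter.\<close>

lemma stage_minD:
  assumes "stage_min G prec N X e"
  shows "e \<in> X" "e \<in> G" "length e \<le> N"
    "\<And>w. w \<in> stage_words G N X \<Longrightarrow> prec\<^sup>=\<^sup>= e w"
proof -
  show e: "e \<in> G" "length e \<le> N" and min: "\<And>w. w \<in> stage_words G N X \<Longrightarrow> prec\<^sup>=\<^sup>= e w"
    using assms by (auto simp: stage_min_def stage_words_def)
  obtain L where L: "L \<in> lists X" "e = concat L"
    using assms by (auto simp: stage_min_def stage_words_def)
  have "\<not> 2 \<le> length L"
  proof
    assume "2 \<le> length L"
    then obtain f where f: "f \<in> stage_words G N X" "prec f e"
      using ex_stage_word_prec[OF L(1)] e L(2) by auto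
    then have "f \<in> G" by (simp add: stage_words_def)
    then show False using le_antisym[of e f] min[OF f(1)] f e prec_irrefl[OF nl] by auto
  qed
  moreover have "L \<noteq> []" using L(2) e G_sub[OF nl, of e] by auto
  ultimately obtain x where "L = [x]" by (cases L; cases "tl L") auto
  then show "e \<in> X" using L by simp
qed

section \<open>Elimination of the least letter\<close>

context
  fixes e :: "'a list"
  assumes e: "stage_min G prec N X e"
begin

text \<open>If \<open>e\<close> is followed by a nonempty rest, it precedes or equals the first
  factor of that rest, and prefixing it yields a factorization with at least two factors.\<close>

lemma stage_word_hd_min:
  assumes "L \<in> lists X" "concat L \<in> stage_words G N X" "L \<noteq> []" "hd L = e"
  shows "L = [e]"
proof (rule ccontr)
  assume "L \<noteq> [e]"
  then obtain R where R: "L = e # R" "R \<noteq> []" using assms(3,4) by (cases L) auto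
  have "length (concat R) \<le> N" "R \<in> lists X"
    using assms R by (auto simp: stage_words_def)
  then obtain Rs where Rs: "is_G_factorization G prec (concat R) (map concat Rs)" "Rs \<noteq> []"
    "\<And>M. M \<in> set Rs \<Longrightarrow> M \<in> lists X \<and> M \<noteq> [] \<and> concat M \<in> stage_words G N X"
    using stage_factorization R(2) by metis
  have "prec\<^sup>=\<^sup>= e (concat (hd Rs))" using stage_minD(4)[OF e] Rs(2,3) by (meson hd_in_set)
  then have "e @ concat R \<notin> G"
    using factorization_Cons[of "concat R" "concat (hd Rs)" "map concat (tl Rs)" e]
      Rs(1,2) stage_minD(2)[OF e] by (cases Rs) auto
  then show False using assms(2) R by (simp add: stage_words_def)
qed

text \<open>If \<open>b e ... e\<close> had a second factor, that factor would start with
  \<open>e\<close> and hence be \<open>e\<close>. The first factor would then be at most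
  \<open>e\<close>, so equal to \<open>e\<close>, although it starts with \<open>b\<close>.\<close>

lemma absorbed_subset: "absorbed N X e \<subseteq> G"
proof
  fix c assume "c \<in> absorbed N X e"
  then obtain b i where b: "c = b @ word_pow e i" "b \<in> X" "b \<noteq> e" "length c \<le> N"
    by (auto simp: absorbed_def)
  let ?L = "b # replicate i e"
  have cL: "concat ?L = c" using b by (simp add: word_pow_def)
  have L: "?L \<in> lists X" "?L \<noteq> []" using b stage_minD(1)[OF e] by auto
  obtain Ls where Ls: "is_G_factorization G prec (concat ?L) (map concat Ls)" "concat Ls = ?L" "Ls \<noteq> []"
    "\<And>M. M \<in> set Ls \<Longrightarrow> M \<in> lists X \<and> M \<noteq> [] \<and> concat M \<in> stage_words G N X"
    using stage_factorization[OF L] b(4) cL by metis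
  show "c \<in> G"
  proof (cases "tl Ls = []")
    case True
    then obtain M where "Ls = [M]" using Ls(3) by (cases Ls) auto
    then show ?thesis using Ls(1) cL unfolding is_G_factorization_def by auto
  next
    case False
    then obtain M K Ks where LsM: "Ls = M # K # Ks" using Ls(3) by (cases Ls; cases "tl Ls") auto
    have M: "M \<in> lists X" "M \<noteq> []" "concat M \<in> stage_words G N X"
      and K: "K \<in> lists X" "K \<noteq> []" "concat K \<in> stage_words G N X"
      using Ls(4) LsM by auto
    have hdM: "hd M = b" using Ls(2) LsM M(2) by (cases M) auto
    have "set K \<subseteq> {e}" using Ls(2) LsM M(2)
      by (cases M) (auto simp: set_replicate_conv_if dest!: arg_cong[where f = set] split: if_splits)
    then have "hd K = e" using K(2) by (cases K) auto
    then have "K = [e]" using stage_word_hd_min K by blast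
    then have "prec\<^sup>=\<^sup>= (concat M) e" using Ls(1) LsM by (simp add: is_G_factorization_def)
    then have "concat M = concat [e]"
      using le_antisym[of "concat M" e] stage_minD(2,4)[OF e] M(3) by (simp add: stage_words_def)
    then have "M = [e]" using stage_inj[OF M(1), of "[e]"] stage_minD(1)[OF e] by simp
    then show ?thesis using hdM b(3) by simp
  qed
qed

text \<open>Append one \<open>e\<close> at a time: every intermediate word is again a letter of the
  new alphabet, hence in \<open>G\<close>, so \<open>prec_append\<close> applies to each
  step.\<close>

lemma prec_append_word_pow:
  assumes "c \<in> absorbed N X e" "c @ word_pow e i \<in> absorbed N X e" "0 < i"
  shows "prec c (c @ word_pow e i)"
proof -
  obtain b l where b: "c = b @ word_pow e l" "b \<in> X" "b \<noteq> e"
    using assms(1) by (auto simp: absorbed_def)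
  have mem: "c @ word_pow e m \<in> absorbed N X e" if "m \<le> i" for m
  proof -
    have "length (c @ word_pow e i) = length (c @ word_pow e m @ word_pow e (i - m))"
      using that by (simp flip: word_pow_add)
    moreover have "length (c @ word_pow e i) \<le> N" using assms(2) unfolding absorbed_def by force
    ultimately have "length (c @ word_pow e m) \<le> N" by simp
    then show ?thesis using b unfolding absorbed_def
      by (intro CollectI exI[of _ b] exI[of _ "l + m"]) (simp add: word_pow_add)
  qed
  have "prec c (c @ word_pow e (Suc m))" if "Suc m \<le> i" for m
    using that
  proof (induction m)
    case 0
    then show ?case
      using prec_append[OF nl, of c e] absorbed_subset mem[of 1] assms(1) stage_minD(2)[OF e]
      by (auto simp: word_pow_def)
  next
    case (Suc m)
    have G: "c \<in> G" "c @ word_pow e (Suc m) \<in> G" "c @ word_pow e (Suc (Suc m)) \<in> G"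
      using absorbed_subset mem Suc.prems assms(1) by (auto simp: subset_iff)
    have "prec (c @ word_pow e (Suc m)) (c @ word_pow e (Suc (Suc m)))"
      using prec_append[OF nl G(2) stage_minD(2)[OF e]] G(3) by (simp add: word_pow_Suc_right)
    moreover have "prec c (c @ word_pow e (Suc m))" using Suc by simp
    ultimately show ?case using prec_trans[OF nl] G by blast
  qed
  from this[of "i - 1"] show ?thesis using assms(3) by simp
qed

text \<open>Expand the word over \<open>X\<close> and factor it there. A factor starting with
  \<open>e\<close> would be \<open>e\<close> itself, which forces the first factor to be
  \<open>e\<close> too; but the expanded word does not start with \<open>e\<close>. So every factor
  can be regrouped.\<close>

lemma stage_absorbed: "stage G prec N (absorbed N X e)"
  unfolding stage_def
proof (intro conjI ballI impI)
  show "absorbed N X e \<subseteq> G" by (rule absorbed_subset)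
  show "inj_on concat (lists (absorbed N X e))"
  proof (rule inj_onI)
    fix L' M' assume LM: "L' \<in> lists (absorbed N X e)" "M' \<in> lists (absorbed N X e)"
      "concat L' = concat M'"
    obtain L M where "L \<in> lists X" "absorb e L = L'" "M \<in> lists X" "absorb e M = M'"
      using absorbed_expand[OF LM(1) stage_minD(1)[OF e]]
        absorbed_expand[OF LM(2) stage_minD(1)[OF e]] by blast
    then show "L' = M'" using stage_inj[of L M] LM(3) by (metis concat_absorb)
  qed
  fix L' assume L': "L' \<in> lists (absorbed N X e)" "L' \<noteq> []" "length (concat L') \<le> N"
  obtain L where L: "L \<in> lists X" "absorb e L = L'" "L = [] \<or> hd L \<noteq> e"
    using absorbed_expand[OF L'(1) stage_minD(1)[OF e]] by blast
  have cL: "concat L' = concat L" using L(2) by (metis concat_absorb)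
  have Lne: "L \<noteq> []" using L L'(2) by auto
  obtain Ls where Ls: "is_G_factorization G prec (concat L) (map concat Ls)" "concat Ls = L" "Ls \<noteq> []"
    "\<And>M. M \<in> set Ls \<Longrightarrow> M \<in> lists X \<and> M \<noteq> [] \<and> concat M \<in> stage_words G N X"
    using stage_factorization[OF L(1) Lne] L'(3) cL by metis
  define H where "H = hd Ls"
  have H: "H \<in> set Ls" "H \<in> lists X" "H \<noteq> []" "concat H \<in> stage_words G N X"
    using Ls(4)[of H] hd_in_set[OF Ls(3)] H_def by auto
  have hdH: "hd H \<noteq> e" using Ls(2,3) H_def H(3) L(3) Lne by (cases Ls) auto
  have hdM: "hd M \<noteq> e" if M: "M \<in> set Ls" for M
  proof
    assume "hd M = e"
    then have "M = [e]" using stage_word_hd_min Ls(4)[OF M] by blast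
    moreover have "prec\<^sup>=\<^sup>= (concat H) (concat M)"
      using Ls(1,3) M H_def by (cases Ls) (auto simp: is_G_factorization_def)
    ultimately have "concat H = concat [e]"
      using le_antisym[of "concat H" e] stage_minD(2,4)[OF e] H(4) by (simp add: stage_words_def)
    then have "H = [e]" using stage_inj[OF H(2), of "[e]"] stage_minD(1)[OF e] by simp
    then show False using hdH by simp
  qed
  have "absorb e M \<in> lists (absorbed N X e)" if M: "M \<in> set Ls" for M
    using absorb_in_absorbed[of M X e N] Ls(4)[OF M] hdM[OF M] by (simp add: stage_words_def)
  then have "set (map (absorb e) Ls) \<subseteq> lists (absorbed N X e)" by auto
  moreover have "map concat (map (absorb e) Ls) = map concat Ls" by simp
  ultimately show "\<exists>Ls. set Ls \<subseteq> lists (absorbed N X e) \<and>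
      is_G_factorization G prec (concat L') (map concat Ls)"
    using Ls(1) cL by metis
qed

text \<open>The word \<open>e\<close> disappears, which makes the elimination terminate.\<close>

lemma stage_words_absorbed: "stage_words G N (absorbed N X e) \<subset> stage_words G N X"
proof -
  have ex: "\<exists>L\<in>lists X. w = concat L \<and> (L = [] \<or> hd L \<noteq> e)"
    if w: "w \<in> concat ` lists (absorbed N X e)" for w
  proof -
    obtain L' where L': "L' \<in> lists (absorbed N X e)" "w = concat L'"
      using w by blast
    show ?thesis using absorbed_expand[OF L'(1) stage_minD(1)[OF e]] L'(2) by auto
  qed
  have "e \<notin> concat ` lists (absorbed N X e)"
  proof
    assume "e \<in> concat ` lists (absorbed N X e)"
    then obtain L where L: "L \<in> lists X" "e = concat L" "L = [] \<or> hd L \<noteq> e" using ex by blast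
    have "L = [e]" by (rule stage_inj) (use L(1,2) stage_minD(1)[OF e] in auto)
    then show False using L(3) by simp
  qed
  moreover have "e \<in> stage_words G N X" using e by (simp add: stage_min_def)
  moreover have "concat ` lists (absorbed N X e) \<subseteq> concat ` lists X" using ex by blast
  ultimately show ?thesis unfolding stage_words_def by blast
qed

section \<open>How the potential changes\<close>

text \<open>The lost copy of \<open>\<nu>\<close> agrees with \<open>\<nu>\<close> except that its
  last block \<open>c\<close> has become \<open>c e ... e\<close>. So \<open>u\<close> is
  \<open>[c]\<close>, the order is the favourable one, and the potential is one more than the number
  of blocks of \<open>\<nu>\<close>.\<close>

lemma slack_after_loss:
  assumes "length \<nu> < 2 ^ Suc j" "\<nu> \<in> lists X" "\<nu> \<noteq> []" "hd \<nu> \<noteq> e"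
    and "r = [] \<or> hd r \<noteq> e" "0 < i" "r \<in> lists X"
    and "length (concat (\<nu> @ replicate i e @ r)) \<le> N"
  shows "slack prec j (absorb e \<nu>) (absorb e (\<nu> @ replicate i e @ r))"
proof -
  let ?c = "last (absorb e \<nu>)" and ?P = "butlast (absorb e \<nu>)"
  have eq: "absorb e (\<nu> @ replicate i e @ r) = ?P @ (?c @ word_pow e i) # absorb e r"
    by (rule absorb_append_replicate_append[OF assms(3,5)])
  have ne: "absorb e \<nu> \<noteq> []" using assms(3) by simp
  have \<nu>: "absorb e \<nu> = ?P @ [?c]" using ne by simp
  have "absorb e \<nu> \<in> lists (absorbed N X e)"
    by (rule absorb_in_absorbed) (use assms in auto)
  then have c: "?c \<in> absorbed N X e" using last_in_set[OF ne] by auto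
  have "absorb e (\<nu> @ replicate i e @ r) \<in> lists (absorbed N X e)"
    by (rule absorb_in_absorbed)
      (use assms stage_minD(1)[OF e] in auto)
  then have ci: "?c @ word_pow e i \<in> absorbed N X e" unfolding eq by simp
  have lt: "prec ?c (?c @ word_pow e i)" using prec_append_word_pow[OF c ci assms(6)] .
  have "?c \<noteq> ?c @ word_pow e i" using lt prec_irrefl[OF nl] c absorbed_subset by (metis subsetD)
  moreover have "2 * length [?c] + length ?P \<le> 2 ^ (j + 1)"
    using length_absorb_le[of e \<nu>] assms(1) ne by (cases "absorb e \<nu>") auto
  \<comment> \<open>With \<open>j = 0\<close> only one block is left, and the first block of the
    rest extends it.\<close>
  moreover have "length (concat (absorb e \<nu>)) \<le> length (hd (?P @ (?c @ word_pow e i) # absorb e r))"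
    if "j = 0"
  proof -
    have "length (absorb e \<nu>) \<le> 1" using length_absorb_le[of e \<nu>] assms(1) that by simp
    then obtain d where "absorb e \<nu> = [d]" using ne by (cases "absorb e \<nu>") auto
    then show ?thesis by (simp del: concat_absorb)
  qed
  ultimately show ?thesis unfolding eq slack_def
    using lt \<nu> by (intro disjI2 exI[of _ ?P] exI[of _ "[?c]"] exI[of _ "(?c @ word_pow e i) # absorb e r"]) auto
qed

text \<open>\<open>\<phi>\<close> is changed only when it starts with \<open>e\<close>; then one
  copy of \<open>\<nu>\<close> moves into it, so that \<open>absorb\<close> never meets a leading
  \<open>e\<close>.\<close>

lemma slack_step:
  assumes "slack prec j \<nu> \<phi>" "\<nu> \<in> lists X" "\<nu> \<noteq> []" "hd \<nu> \<noteq> e" "\<phi> \<in> lists X"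
    and "length (concat \<nu>) \<le> N" "length (concat (word_pow \<nu> j @ \<phi>)) \<le> N"
  shows "\<exists>j' \<phi>'. \<phi>' \<in> lists X \<and> (\<phi>' = [] \<or> hd \<phi>' \<noteq> e) \<and>
    word_pow \<nu> j @ \<phi> = word_pow \<nu> j' @ \<phi>' \<and> slack prec j' (absorb e \<nu>) (absorb e \<phi>')"
proof -
  have eX: "e \<in> X" using stage_minD(1)[OF e] .
  have XG: "X \<subseteq> G" using X unfolding stage_def by blast
  \<comment> \<open>As \<open>\<nu>\<close> is nonempty, the bound gives \<open>j > 0\<close>, so
    there is a copy to lose.\<close>
  have loss: ?thesis if \<nu>j: "length \<nu> < 2 ^ j" and \<phi>: "\<phi> \<noteq> []" "hd \<phi> = e"
  proof -
    obtain i r where r: "\<phi> = replicate i e @ r" "r = [] \<or> hd r \<noteq> e" by (rule split_leading)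
    have i: "0 < i" using r \<phi> by (cases i) auto
    obtain j' where j': "j = Suc j'" using \<nu>j assms(3) by (cases j) auto
    have "word_pow \<nu> j @ \<phi> = word_pow \<nu> j' @ (\<nu> @ replicate i e @ r)"
      using r j' by (simp add: word_pow_Suc_right)
    moreover from this have "length (concat (\<nu> @ replicate i e @ r)) \<le> N"
      using assms(7) by simp
    moreover have "\<nu> @ replicate i e @ r \<in> lists X" "r \<in> lists X" using assms(2,5) r by auto
    ultimately show ?thesis
      using slack_after_loss[of \<nu> j' r i] \<nu>j j' assms(2-4) r i
      by (intro exI[of _ j'] exI[of _ "\<nu> @ replicate i e @ r"]) auto
  qed
  have len\<phi>: "length (concat \<phi>) \<le> N" using assms(7) by simp
  show ?thesis
  proof (cases "length \<nu> < 2 ^ j")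
    case True
    show ?thesis
    proof (cases "\<phi> \<noteq> [] \<and> hd \<phi> = e")
      case False
      have "slack prec j (absorb e \<nu>) (absorb e \<phi>)"
        using True length_absorb_le[of e \<nu>] by (simp add: slack_def)
      with False show ?thesis using assms(5) by blast
    qed (use loss True in blast)
  next
    case False
    then obtain P u v where Puv: "\<nu> = P @ u" "\<phi> = P @ v" "u \<noteq> []" "v \<noteq> []" "hd u \<noteq> hd v"
      "2 * length u + length P \<le> 2 ^ (j + 1)"
      "prec (hd u) (hd v) \<or> 2 * length u + length P < 2 ^ (j + 1)"
      "j = 0 \<longrightarrow> length (concat \<nu>) \<le> length (hd \<phi>)"
      using assms(1) unfolding slack_def by blast
    have uv: "hd u \<in> X" "hd v \<in> X" "u \<in> lists X" "v \<in> lists X" "P \<in> lists X"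
      using Puv(1-4) assms(2,5) by auto
    have emin: "prec\<^sup>=\<^sup>= e x" if "x \<in> X" "length x \<le> N" for x
    proof -
      have "x \<in> stage_words G N X"
        using that XG by (auto simp: stage_words_def intro!: image_eqI[of _ _ "[x]"])
      then show ?thesis using stage_minD(4)[OF e] by blast
    qed
    have lhd: "length (hd u) \<le> N" "length (hd v) \<le> N"
      using assms(6) len\<phi> Puv(1-4) by (cases u; cases v; simp)+
    show ?thesis
    proof (cases "P = [] \<and> hd v = e")
      case True
      \<comment> \<open>Since \<open>hd v\<close> is the least letter \<open>e\<close>, the strict
        bound on the potential must hold; with \<open>P\<close> empty it says that
        \<open>\<nu>\<close> has fewer than \<open>2 ^ j\<close> letters.\<close>
      then have "\<not> prec (hd u) (hd v)"
        using emin[OF uv(1) lhd(1)] le_antisym[of "hd u" e] Puv(5) uv XG by blast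
      then have "length \<nu> < 2 ^ j" using Puv True by simp
      then show ?thesis using loss Puv(2,4) True by simp
    next
      case notloss: False
      have hd\<phi>: "\<phi> \<noteq> []" "hd \<phi> \<noteq> e" using notloss Puv(1,2,4) assms(4) by (cases P; auto)+
      have j0: "j = 0 \<longrightarrow> length (concat (absorb e \<nu>)) \<le> length (hd (absorb e \<phi>))"
      proof -
        obtain i where "hd (absorb e \<phi>) = hd \<phi> @ word_pow e i" using hd_absorb hd\<phi>(1) by metis
        then show ?thesis using Puv(8) by auto
      qed
      have in\<nu>: "absorb e \<nu> \<in> lists (absorbed N X e)"
        by (rule absorb_in_absorbed) (use assms in auto)
      have in\<phi>: "absorb e \<phi> \<in> lists (absorbed N X e)"
        by (rule absorb_in_absorbed) (use assms(5) len\<phi> hd\<phi> in auto)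
      let ?p = "last (absorb e P)" and ?P = "butlast (absorb e P)"
      have "slack prec j (absorb e \<nu>) (absorb e \<phi>)"
      proof -
        consider (u) "hd u = e" | (v) "hd v = e" "hd u \<noteq> e" | (none) "hd u \<noteq> e" "hd v \<noteq> e" by blast
        then show ?thesis
        proof cases
          \<comment> \<open>\<open>P\<close> gives up its last block to \<open>u\<close>, which in
            turn loses at least one leading \<open>e\<close>. Thus \<open>u\<close> does not grow
            and \<open>P\<close> shrinks, making the bound strict.\<close>
          case u
          have P: "P \<noteq> []" using u assms(4) Puv(1) by auto
          then have P': "absorb e P \<noteq> []" by simp
          obtain i r where r: "u = replicate i e @ r" "r = [] \<or> hd r \<noteq> e" by (rule split_leading)
          have i: "0 < i" using r u Puv(3) by (cases i) auto
          have eq\<nu>: "absorb e \<nu> = ?P @ (?p @ word_pow e i) # absorb e r"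
            using absorb_append_replicate_append[OF P r(2)] Puv(1) r(1) by simp
          have "absorb e \<phi> = absorb e P @ absorb e v" using absorb_append[of v e P] Puv(2,5) u by simp
          then have eq\<phi>: "absorb e \<phi> = ?P @ ?p # absorb e v" using P'
            by (metis append_Cons append_Nil append_assoc append_butlast_last_id)
          have mem: "?p \<in> absorbed N X e" "?p @ word_pow e i \<in> absorbed N X e"
            using in\<nu> in\<phi> unfolding eq\<nu> eq\<phi> by auto
          have "prec ?p (?p @ word_pow e i)" using prec_append_word_pow[OF mem i] .
          then have "?p @ word_pow e i \<noteq> ?p"
            using prec_irrefl[OF nl] mem absorbed_subset by (metis subsetD)
          moreover have "2 * length ((?p @ word_pow e i) # absorb e r) + length ?P < 2 ^ (j + 1)"
            using Puv(6) r(1) i P length_absorb_le[of e r] length_absorb_le[of e P]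
            by (cases P) auto
          ultimately show ?thesis using j0 unfolding slack_def eq\<nu> eq\<phi>
            by (intro disjI2 exI[of _ ?P] exI[of _ "(?p @ word_pow e i) # absorb e r"]
                exI[of _ "?p # absorb e v"]) auto
        next
          \<comment> \<open>Here \<open>u\<close> gains a block and \<open>P\<close> loses one, so
            the potential grows by at most 1. The old bound was strict because \<open>e\<close> is
            least, and the new heads are in the favourable order.\<close>
          case v
          have P: "P \<noteq> []" using v notloss by auto
          then have P': "absorb e P \<noteq> []" by simp
          have strict: "2 * length u + length P < 2 ^ (j + 1)"
            using Puv(7) emin[OF uv(1) lhd(1)] le_antisym[of "hd u" e] v uv XG by blast
          obtain i r where r: "v = replicate i e @ r" "r = [] \<or> hd r \<noteq> e" by (rule split_leading)
          have i: "0 < i" using r v Puv(4) by (cases i) auto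
          have eq\<phi>: "absorb e \<phi> = ?P @ (?p @ word_pow e i) # absorb e r"
            using absorb_append_replicate_append[OF P r(2)] Puv(2) r(1) by simp
          have "absorb e \<nu> = absorb e P @ absorb e u" using absorb_append[of u e P] Puv(1) v by simp
          then have eq\<nu>: "absorb e \<nu> = ?P @ ?p # absorb e u" using P'
            by (metis append_Cons append_Nil append_assoc append_butlast_last_id)
          have mem: "?p \<in> absorbed N X e" "?p @ word_pow e i \<in> absorbed N X e"
            using in\<nu> in\<phi> unfolding eq\<nu> eq\<phi> by auto
          have lt: "prec ?p (?p @ word_pow e i)" using prec_append_word_pow[OF mem i] .
          then have "?p \<noteq> ?p @ word_pow e i"
            using prec_irrefl[OF nl] mem absorbed_subset by (metis subsetD)
          moreover have "2 * length (?p # absorb e u) + length ?P \<le> 2 ^ (j + 1)"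
            using strict P length_absorb_le[of e u] length_absorb_le[of e P]
            by (cases P) auto
          ultimately show ?thesis using j0 lt unfolding slack_def eq\<nu> eq\<phi>
            by (intro disjI2 exI[of _ ?P] exI[of _ "?p # absorb e u"]
                exI[of _ "(?p @ word_pow e i) # absorb e r"]) auto
        next
          case none
          have eq: "absorb e \<nu> = absorb e P @ absorb e u" "absorb e \<phi> = absorb e P @ absorb e v"
            using absorb_append Puv(1,2) none by blast+
          obtain i where i: "hd (absorb e u) = hd u @ word_pow e i"
            "length (absorb e u) + i \<le> length u" using hd_absorb Puv(3) by metis
          obtain l where l: "hd (absorb e v) = hd v @ word_pow e l" using hd_absorb Puv(4) by metis
          have ne: "absorb e u \<noteq> []" "absorb e v \<noteq> []" using Puv(3,4) by auto
          have mem: "hd (absorb e u) \<in> absorbed N X e" "hd (absorb e v) \<in> absorbed N X e"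
            using in\<nu> in\<phi> hd_in_set[OF ne(1)] hd_in_set[OF ne(2)] unfolding eq by auto
          have memG: "hd (absorb e u) \<in> G" "hd (absorb e v) \<in> G"
            using mem absorbed_subset by auto
          have neq: "hd (absorb e u) \<noteq> hd (absorb e v)"
          proof
            assume "hd (absorb e u) = hd (absorb e v)"
            then have "concat (hd u # replicate i e) = concat (hd v # replicate l e)"
              using i(1) l by (simp add: word_pow_def)
            then have "hd u # replicate i e = hd v # replicate l e"
              by (rule stage_inj[rotated 2]) (use uv eX in auto)
            then show False using Puv(5) by simp
          qed
          have bound: "2 * length (absorb e u) + length (absorb e P) + 2 * i \<le> 2 * length u + length P"
            using i(2) length_absorb_le[of e P] by simp
          \<comment> \<open>If \<open>hd u\<close> absorbs nothing, it stays below
            \<open>hd v\<close>, which can only increase. If it absorbs some \<open>e\<close>, the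
            list \<open>u\<close> gets shorter and the bound becomes strict.\<close>
          have ord: "prec (hd (absorb e u)) (hd (absorb e v)) \<or>
            2 * length (absorb e u) + length (absorb e P) < 2 ^ (j + 1)"
          proof (cases "i = 0 \<and> prec (hd u) (hd v)")
            case True
            have "hd v \<in> absorbed N X e" using uv(2) none(2) lhd(2) unfolding absorbed_def
              by (intro CollectI exI[of _ "hd v"] exI[of _ 0]) (auto simp: word_pow_def)
            then have "prec\<^sup>=\<^sup>= (hd v) (hd (absorb e v))"
              using prec_append_word_pow[of "hd v" l] mem(2) l by (cases l) (auto simp: word_pow_def)
            moreover have "hd (absorb e u) = hd u" using i(1) True by (simp add: word_pow_def)
            ultimately have "prec\<^sup>=\<^sup>= (hd (absorb e u)) (hd (absorb e v))"
              using le_trans[of "hd u" "hd v" "hd (absorb e v)"] True uv(1,2) XG memG by auto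
            then show ?thesis using neq by auto
          next
            case False
            then show ?thesis using bound Puv(6,7) by auto
          qed
          show ?thesis using j0 ord bound Puv(6) ne neq unfolding slack_def eq
            by (intro disjI2 exI[of _ "absorb e P"] exI[of _ "absorb e u"] exI[of _ "absorb e v"]) auto
        qed
      qed
      then show ?thesis using assms(5) hd\<phi> by blast
    qed
  qed
qed

end

section \<open>Iterating the elimination\<close>

lemma ex_stage_min:
  assumes "finite (stage_words G N X)" "stage_words G N X \<noteq> {}"
  shows "\<exists>e. stage_min G prec N X e"
proof -
  have "\<exists>e\<in>S. \<forall>w\<in>S. prec\<^sup>=\<^sup>= e w" if "finite S" "S \<noteq> {}" "S \<subseteq> G" for S
    using that
  proof (induction S rule: finite_ne_induct)
    case (insert x F)
    then obtain m where m: "m \<in> F" "\<forall>w\<in>F. prec\<^sup>=\<^sup>= m w" by auto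
    show ?case
    proof (cases "prec\<^sup>=\<^sup>= m x")
      case False
      then have "prec x m" using prec_total[OF nl, of m x] insert.prems m by auto
      then have "\<forall>w\<in>F. prec\<^sup>=\<^sup>= x w"
        using m le_trans[of x m] insert.prems by (metis insert_subset subsetD sup2CI)
      then show ?thesis by auto
    qed (use m in auto)
  qed auto
  from this[OF assms] show ?thesis by (auto simp: stage_min_def stage_words_def)
qed

end

lemma finite_stage_words: "finite A \<Longrightarrow> finite (stage_words G N X)"
  by (rule finite_subset[OF _ finite_lists_length_le[of A N]])
    (use G_sub[OF nl] in \<open>auto simp: stage_words_def\<close>)

text \<open>Induction on the number of bounded words of \<open>G\<close> over the alphabet. It stops
  when \<open>\<nu>\<close> starts with the least letter \<open>e\<close>, for then
  \<open>\<nu> = [e]\<close>; every factor is now at least \<open>e\<close>, and only the length of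
  the first one remains to be checked.\<close>

lemma slack_factorization:
  assumes "finite A" "stage G prec N X" "\<nu> \<in> lists X" "\<phi> \<in> lists X" "slack prec j \<nu> \<phi>"
    and "concat \<nu> \<in> G" "length (concat \<nu>) \<le> N" "length (concat (word_pow \<nu> j @ \<phi>)) \<le> N"
  shows "\<exists>x xs. is_G_factorization G prec (concat (word_pow \<nu> j @ \<phi>)) (x # xs) \<and>
    length (concat \<nu>) \<le> length x \<and> prec\<^sup>=\<^sup>= (concat \<nu>) x"
  using assms(2-)
proof (induction "card (stage_words G N X)" arbitrary: X \<nu> \<phi> j rule: less_induct)
  case less
  note X = less.prems(1)
  have n: "concat \<nu> \<in> stage_words G N X" using less.prems by (simp add: stage_words_def)
  have \<nu>ne: "\<nu> \<noteq> []" using G_sub[OF nl less.prems(5)] by auto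
  obtain e where e: "stage_min G prec N X e"
    using ex_stage_min[OF X finite_stage_words[OF assms(1)]] n by blast
  show ?case
  proof (cases "hd \<nu> = e")
    case True
    then have \<nu>: "\<nu> = [e]" using stage_word_hd_min[OF X e less.prems(2) n \<nu>ne] by simp
    let ?M = "word_pow \<nu> j @ \<phi>"
    \<comment> \<open>The first letter is \<open>e\<close> if a copy remains. If none does, the
      clause of \<open>slack\<close> for \<open>j = 0\<close> bounds the length of
      \<open>hd \<phi>\<close>, since \<open>[e]\<close> is too long for the other
      alternative.\<close>
    have M: "?M \<noteq> [] \<and> length e \<le> length (hd ?M)"
    proof (cases j)
      case 0
      then show ?thesis using less.prems(4) \<nu> by (auto simp: slack_def word_pow_def)
    qed (simp add: \<nu> word_pow_Suc)
    have "?M \<in> lists X" using less.prems(2,3) by (auto simp: word_pow_def)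
    then obtain Ls where Ls: "is_G_factorization G prec (concat ?M) (map concat Ls)" "concat Ls = ?M"
      "Ls \<noteq> []" "\<And>L. L \<in> set Ls \<Longrightarrow> L \<in> lists X \<and> L \<noteq> [] \<and> concat L \<in> stage_words G N X"
      using stage_factorization[OF X, of ?M] M less.prems(7) by metis
    obtain H Hs where H: "Ls = H # Hs" using Ls(3) by (cases Ls) auto
    have Hin: "H \<noteq> []" "concat H \<in> stage_words G N X" using Ls(4) H by auto
    have "hd H = hd ?M" using Ls(2) H Hin(1) by (metis concat.simps(2) hd_append2)
    then have "length e \<le> length (concat H)" using M Hin(1) by (cases H) auto
    moreover have "prec\<^sup>=\<^sup>= e (concat H)" using stage_minD(4)[OF X e Hin(2)] .
    ultimately show ?thesis using Ls(1) H \<nu> by auto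
  next
    case False
    obtain j' \<phi>' where \<phi>': "\<phi>' \<in> lists X" "\<phi>' = [] \<or> hd \<phi>' \<noteq> e"
      "word_pow \<nu> j @ \<phi> = word_pow \<nu> j' @ \<phi>'" "slack prec j' (absorb e \<nu>) (absorb e \<phi>')"
      using slack_step[OF X e less.prems(4,2) \<nu>ne False less.prems(3,6,7)] by blast
    have len: "length (concat \<phi>') \<le> N" using less.prems(7) \<phi>'(3) by simp
    have ceq: "concat (word_pow (absorb e \<nu>) j' @ absorb e \<phi>') = concat (word_pow \<nu> j @ \<phi>)"
      using \<phi>'(3) by (simp add: concat_word_pow)
    have "card (stage_words G N (absorbed N X e)) < card (stage_words G N X)"
      using psubset_card_mono[OF finite_stage_words[OF assms(1)] stage_words_absorbed[OF X e]] .
    from less.hyps[OF this stage_absorbed[OF X e], of "absorb e \<nu>" "absorb e \<phi>'" j']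
    show ?thesis
      using absorb_in_absorbed[OF less.prems(2), of e N] absorb_in_absorbed[OF \<phi>'(1,2) len]
        False \<phi>'(4) less.prems(5-7) unfolding ceq by simp
  qed
qed

lemma stage_letters: "stage G prec N ((\<lambda>x. [x]) ` A)"
  unfolding stage_def
proof (intro conjI ballI impI)
  have letters: "concat (map (\<lambda>x. [x]) w) = w" for w :: "'a list" by (induction w) auto
  show "(\<lambda>x. [x]) ` A \<subseteq> G" using nl by (auto simp: nyldon_like_def)
  have "map (\<lambda>x. [x]) (concat L) = L" if "L \<in> lists ((\<lambda>x. [x]) ` A)" for L
    using that by (induction L) auto
  then show "inj_on concat (lists ((\<lambda>x. [x]) ` A))" by (metis inj_onI)
  fix L assume L: "L \<in> lists ((\<lambda>x. [x]) ` A)" "L \<noteq> []"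
  have "concat L \<in> lists A" using L(1) by fastforce
  moreover have "concat L \<noteq> []" using L by (cases L) auto
  ultimately obtain ws where ws: "is_G_factorization G prec (concat L) ws"
    using ex_factorization[OF nl] by blast
  have "set (map (map (\<lambda>x. [x])) ws) \<subseteq> lists ((\<lambda>x. [x]) ` A)"
    using ws G_sub[OF nl] by (fastforce simp: is_G_factorization_def)
  moreover have "map concat (map (map (\<lambda>x. [x])) ws) = ws" by (simp add: letters map_idI)
  ultimately show "\<exists>Ls. set Ls \<subseteq> lists ((\<lambda>x. [x]) ` A) \<and>
      is_G_factorization G prec (concat L) (map concat Ls)"
    using ws by metis
qed

end

section \<open>From single letters to the word in question\<close>

theorem theorem4p4:
  fixes A :: "'a set" and G :: "'a list set" and prec :: "'a list \<Rightarrow> 'a list \<Rightarrow> bool"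
    and n s a :: "'a list" and k :: nat
  assumes "finite A" and "2 \<le> card A"
    and "nyldon_like A G prec"
    and "n \<in> G"
    and "s \<noteq> []" and "suffix s n"
    and "a \<in> lists A"
    and "real k > log 2 (real (length n))"
  shows "s @ word_pow n k @ a \<notin> G \<and>
         (\<exists>x xs. G_factorization G prec (word_pow n k @ a) = x # xs \<and>
            length n \<le> length x \<and> prec\<^sup>=\<^sup>= n x)"
proof -
  note nl = assms(3)
  let ?W = "word_pow n k @ a" and ?l = "map (\<lambda>x. [x])"
  have n: "n \<in> lists A" "n \<noteq> []" using G_sub[OF nl assms(4)] by auto
  have letters: "concat (?l w) = w" for w :: "'a list" by (induction w) auto
  have "real (length n) < 2 powr real k" using assms(8) n(2) by (simp add: log_less_iff)
  then have "real (length n) < real (2 ^ k)" by (simp add: powr_realpow)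
  then have k: "length n < 2 ^ k" by (simp only: of_nat_less_iff)
  have W: "concat (word_pow (?l n) k @ ?l a) = ?W" by (simp add: concat_word_pow letters)
  have "\<exists>x xs. is_G_factorization G prec (concat (word_pow (?l n) k @ ?l a)) (x # xs) \<and>
      length (concat (?l n)) \<le> length x \<and> prec\<^sup>=\<^sup>= (concat (?l n)) x"
  \<comment> \<open>The length bound is chosen to cover both \<open>n\<close> and the whole
    word.\<close>
  proof (rule slack_factorization[OF nl assms(1) stage_letters[OF nl, of "length n + length ?W"]])
    \<comment> \<open>Over single letters \<open>n\<close> has fewer than \<open>2 ^ k\<close>
      letters, so \<open>slack\<close> starts in its first alternative.\<close>
    show "slack prec k (?l n) (?l a)" using k by (simp add: slack_def)
    show "length (concat (word_pow (?l n) k @ ?l a)) \<le> length n + length ?W" unfolding W by simp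
    show "length (concat (?l n)) \<le> length n + length ?W" unfolding letters by simp
  qed (use n assms(4,7) letters in auto)
  then obtain x xs where x: "is_G_factorization G prec ?W (x # xs)" "length n \<le> length x" "prec\<^sup>=\<^sup>= n x"
    unfolding W letters by blast
  have "G_factorization G prec ?W = x # xs"
    unfolding G_factorization_def using x(1) factorization_unique[OF nl] by blast
  moreover have "s @ ?W \<notin> G"
  proof -
    have "s \<in> lists A" using n(1) assms(6) by (auto simp: suffix_def)
    then obtain ss where ss: "is_G_factorization G prec s ss"
      using ex_factorization[OF nl] assms(5) by blast
    obtain us z where z: "ss = us @ [z]" "z \<in> G" "s = concat us @ z"
      using factorization_last[OF nl ss] by metis
    have "suffix z n" using z(3) assms(6) by (auto simp: suffix_def)
    then have "prec\<^sup>=\<^sup>= z n"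
      using proper_suffix_prec[OF nl assms(4) _ z(2)] by (auto simp: strict_suffix_def)
    moreover have "x \<in> G" using x(1) by (simp add: is_G_factorization_def)
    ultimately have "prec\<^sup>=\<^sup>= z x" using le_trans[OF nl _ x(3)] z(2) assms(4) by blast
    then have "is_G_factorization G prec (s @ ?W) (ss @ x # xs)"
      using factorization_append[OF nl ss x(1)] z(1) by simp
    then show ?thesis using not_in_G[OF nl] z(1) by fastforce
  qed
  ultimately show ?thesis using x by blast
qed

end
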